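(* Let $\mathcal{X}=\{x_1,\dots,x_N\}$ be finite, let $L:\mathcal{X}\times\mathcal{A}\to\mathbb{R}$ be a bounded loss function, and let $\mathcal{P}$ be the set of all probability distributions on $\mathcal{X}$, identified with the unit simplex in $\mathbb{R}^N$ with its usual topology. Let $\Gamma$ be a nonempty closed convex subset of $\mathcal{P}$. Then the restricted game $\mathcal{G}^\Gamma=(\Gamma,\mathcal{A},L)$ has a finite value $H^*$, and the entropy $H(P)$ achieves its maximum $H^*$ over $\Gamma$ at some distribution $P^*\in\Gamma$.
   Context: $\mathcal{A}$ is a (nonempty) measurable action space whose $\sigma$-field contains all singletons, and $L$ is jointly measurable. For $P\in\mathcal{P}$ and a randomized act $\zeta$ (a probability distribution on $\mathcal{A}$; the set of all of these is $\mathcal{Z}$), $L(P,a):=E_P\{L(X,a)\}$ and $L(P,\zeta):=E_{(X,A)\sim P\times\zeta}\{L(X,A)\}$. The generalized entropy is $H(P):=\inf_{a\in\mathcal{A}}L(P,a)$. In the restricted game $\mathcal{G}^\Gamma$ Nature chooses $P\in\Gamma$, the Decision Maker chooses $\zeta\in\mathcal{Z}$ and the loss is $L(P,\zeta)$. The game has value $V$ if $V=\sup_{P\in\Gamma}\inf_{\zeta\in\mathcal{Z}}L(P,\zeta)=\inf_{\zeta\in\mathcal{Z}}\sup_{P\in\Gamma}L(P,\zeta)$ is finite. *)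

theory Defs
  imports "HOL-Probability.Probability"
begin

(* The sample space is a finite type 'x with its full power set as sigma-field, so probability
   distributions on it are values of type 'x pmf. The action space is a measure A of which only
   space and sets are used; randomized acts are the elements of space (prob_algebra A), i.e. the
   probability measures on that sigma-field. *)

(* The identification of distributions on 'x with the unit simplex. *)
definition pmf_vec :: "'x::finite pmf \<Rightarrow> real ^ 'x" where
  "pmf_vec P = (\<chi> i. pmf P i)"

lemma inj_pmf_vec: "inj pmf_vec"
  by (auto intro!: injI pmf_eqI simp: pmf_vec_def vec_eq_iff)

lemma range_pmf_vec:
  "range pmf_vec = {v :: real ^ 'x::finite. (\<forall>i. 0 \<le> v $ i) \<and> (\<Sum>i\<in>UNIV. v $ i) = 1}"
proof (intro equalityI subsetI)
  fix v :: "real ^ 'x" assume "v \<in> range pmf_vec"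
  then show "v \<in> {v. (\<forall>i. 0 \<le> v $ i) \<and> (\<Sum>i\<in>UNIV. v $ i) = 1}"
    by (auto simp: pmf_vec_def sum_pmf_eq_1)
next
  fix v :: "real ^ 'x" assume "v \<in> {v. (\<forall>i. 0 \<le> v $ i) \<and> (\<Sum>i\<in>UNIV. v $ i) = 1}"
  then have nn: "\<And>i. 0 \<le> v $ i" and s: "(\<Sum>i\<in>UNIV. v $ i) = 1" by auto
  have "(\<integral>\<^sup>+ i. ennreal (v $ i) \<partial>count_space UNIV) = 1"
    using nn s by (simp add: nn_integral_count_space_finite sum_ennreal)
  then have "pmf (embed_pmf (\<lambda>i. v $ i)) i = v $ i" for i
    using nn by (intro pmf_embed_pmf) auto
  then have "v = pmf_vec (embed_pmf (\<lambda>i. v $ i))"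
    by (simp add: pmf_vec_def vec_eq_iff)
  then show "v \<in> range pmf_vec" by blast
qed

definition closed_pmf_set :: "'x::finite pmf set \<Rightarrow> bool" where
  "closed_pmf_set \<Gamma> \<longleftrightarrow> closedin (top_of_set (range pmf_vec)) (pmf_vec ` \<Gamma>)"

definition convex_pmf_set :: "'x::finite pmf set \<Rightarrow> bool" where
  "convex_pmf_set \<Gamma> \<longleftrightarrow> convex (pmf_vec ` \<Gamma>)"

definition loss_act :: "('x \<Rightarrow> 'a \<Rightarrow> real) \<Rightarrow> 'x pmf \<Rightarrow> 'a \<Rightarrow> real" where
  "loss_act L P a = measure_pmf.expectation P (\<lambda>x. L x a)"

definition loss_rand :: "('x \<Rightarrow> 'a \<Rightarrow> real) \<Rightarrow> 'x pmf \<Rightarrow> 'a measure \<Rightarrow> real" where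
  "loss_rand L P \<zeta> = (\<integral>z. L (fst z) (snd z) \<partial>(measure_pmf P \<Otimes>\<^sub>M \<zeta>))"

(* Infima and suprema are taken in the extended reals, where they carry no side conditions. *)
definition gen_entropy :: "'a measure \<Rightarrow> ('x \<Rightarrow> 'a \<Rightarrow> real) \<Rightarrow> 'x pmf \<Rightarrow> ereal" where
  "gen_entropy A L P = (INF a\<in>space A. ereal (loss_act L P a))"

(* V is a real number: having a value includes its being finite. *)
definition game_has_value ::
    "'x pmf set \<Rightarrow> 'a measure \<Rightarrow> ('x \<Rightarrow> 'a \<Rightarrow> real) \<Rightarrow> real \<Rightarrow> bool" where
  "game_has_value \<Gamma> A L V \<longleftrightarrow>
     ereal V = (SUP P\<in>\<Gamma>. INF \<zeta>\<in>space (prob_algebra A). ereal (loss_rand L P \<zeta>)) \<and>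
     ereal V = (INF \<zeta>\<in>space (prob_algebra A). SUP P\<in>\<Gamma>. ereal (loss_rand L P \<zeta>))"

end

theory Submission
  imports Defs
begin

text \<open>
  Losses of randomized acts against \<open>P\<close> are inner products of the probability vector of \<open>P\<close> with
  points of the convex hull \<open>S\<close> of the loss vectors \<open>(L x a)\<^sub>x\<close>. The entropy is an infimum of
  uniformly Lipschitz linear functions, so it attains its maximum over the compact set \<open>\<Gamma>\<close>.
  If \<open>c\<close> exceeds the maximum, then \<open>S\<close> meets \<open>D = {w. \<forall>p\<in>\<Gamma>. p \<bullet> w \<le> c}\<close>: otherwise a hyperplane
  separates the two, its normal lies in the cone over \<open>\<Gamma>\<close> because \<open>D\<close> recedes along the polar of
  that cone, and after rescaling the normal is a \<open>p \<in> \<Gamma>\<close> with entropy at least \<open>c\<close>.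
\<close>

section \<open>A minimax principle for convex sets\<close>

text \<open>By Cauchy-Schwarz all the functions \<open>\<lambda>p. p \<bullet> w\<close> share a
  norm bound \<open>B\<close> of \<open>W\<close> as Lipschitz constant, and their infimum inherits
  it.\<close>

lemma continuous_on_INF_inner:
  fixes W :: "'a::real_inner set"
  assumes "W \<noteq> {}" "bounded W"
  shows "continuous_on X (\<lambda>p. INF w\<in>W. p \<bullet> w)"
proof -
  obtain B where B: "\<And>w. w \<in> W \<Longrightarrow> norm w \<le> B" "B > 0"
    using \<open>bounded W\<close> by (auto simp: bounded_pos)
  have bdd: "bdd_below ((\<lambda>w. p \<bullet> w) ` W)" for p
  proof (rule bdd_belowI2)
    fix w assume "w \<in> W"
    have "\<bar>p \<bullet> w\<bar> \<le> norm p * norm w" by (rule Cauchy_Schwarz_ineq2)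
    also have "\<dots> \<le> norm p * B" using B(1)[OF \<open>w \<in> W\<close>] by (simp add: mult_left_mono)
    finally show "- (norm p * B) \<le> p \<bullet> w" by linarith
  qed
  have le: "(INF w\<in>W. p \<bullet> w) - B * dist p q \<le> (INF w\<in>W. q \<bullet> w)" for p q
  proof (rule cINF_greatest[OF \<open>W \<noteq> {}\<close>])
    fix w assume w: "w \<in> W"
    have "(p - q) \<bullet> w \<le> norm (p - q) * norm w" by (rule norm_cauchy_schwarz)
    also have "\<dots> \<le> norm (p - q) * B" using B(1)[OF w] by (simp add: mult_left_mono)
    finally have "p \<bullet> w - B * dist p q \<le> q \<bullet> w"
      by (simp add: inner_diff_left dist_norm mult.commute)
    then show "(INF w\<in>W. p \<bullet> w) - B * dist p q \<le> q \<bullet> w"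
      using cINF_lower[OF bdd w, of p] by linarith
  qed
  have "B-lipschitz_on X (\<lambda>p. INF w\<in>W. p \<bullet> w)"
  proof (rule lipschitz_onI)
    fix p q
    show "dist (INF w\<in>W. p \<bullet> w) (INF w\<in>W. q \<bullet> w) \<le> B * dist p q"
      using le[of p q] le[of q p] by (simp add: dist_real_def dist_commute abs_le_iff)
  qed (use B in simp)
  then show ?thesis by (rule lipschitz_on_continuous_on)
qed

text \<open>A recession argument: a \<open>u\<close> outside the cone is separated from it by some
  \<open>z\<close> that is nonnegative on \<open>K\<close> and negative at \<open>u\<close>. Moving
  from \<open>v\<close> along \<open>-z\<close> then keeps every constraint
  \<open>p \<bullet> w \<le> c\<close>, while \<open>u \<bullet> w\<close> grows without bound. The
  point \<open>v\<close> ensures that the constraints can be met at all.\<close>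

lemma conic_hull_if_bounded_on_halfspaces:
  fixes K :: "'a::euclidean_space set"
  assumes "compact K" "convex K" "K \<noteq> {}" "0 \<notin> K"
    and bound: "\<And>w. (\<And>p. p \<in> K \<Longrightarrow> p \<bullet> w \<le> c) \<Longrightarrow> u \<bullet> w \<le> b"
    and v: "\<And>p. p \<in> K \<Longrightarrow> p \<bullet> v \<le> c"
  shows "u \<in> conic hull K"
proof (rule ccontr)
  assume "u \<notin> conic hull K"
  \<comment> \<open>The conic hull is closed because \<open>K\<close> is compact and avoids 0, so
    the separation is strict.\<close>
  then obtain z d where z: "z \<bullet> u < d" "\<And>x. x \<in> conic hull K \<Longrightarrow> d < z \<bullet> x"
    using separating_hyperplane_closed_point[of "conic hull K" u]
      closed_conic_hull[of K] convex_conic_hull[of K] assms(1-4) by auto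
  have "0 \<in> conic hull K" using \<open>K \<noteq> {}\<close> by (force simp: conic_hull_explicit)
  from z(2)[OF this] have "d < 0" by simp
  have z_nonneg: "0 \<le> z \<bullet> p" if "p \<in> K" for p
  proof (rule ccontr)
    assume neg: "\<not> 0 \<le> z \<bullet> p"
    \<comment> \<open>Both \<open>d\<close> and \<open>z \<bullet> p\<close> are negative, so this
      is a point of the cone; its inner product with \<open>z\<close> is exactly \<open>d\<close>,
      against strictness.\<close>
    then have "(d / (z \<bullet> p)) *\<^sub>R p \<in> conic hull K"
      using that \<open>d < 0\<close> by (auto simp: conic_hull_explicit intro!: exI divide_nonpos_neg)
    from z(2)[OF this] neg show False by simp
  qed
  have "z \<bullet> u < 0" using z(1) \<open>d < 0\<close> by simp
  \<comment> \<open>With this step length \<open>u \<bullet> (v - s *\<^sub>R z)\<close> is at least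
    \<open>\<bar>b\<bar> + 1\<close>, hence above \<open>b\<close>.\<close>
  define s where "s = (\<bar>b\<bar> + \<bar>u \<bullet> v\<bar> + 1) / - (z \<bullet> u)"
  have "s \<ge> 0" using \<open>z \<bullet> u < 0\<close> by (simp add: s_def divide_nonneg_neg)
  have "u \<bullet> (v - s *\<^sub>R z) \<le> b"
  proof (rule bound)
    fix p assume "p \<in> K"
    then show "p \<bullet> (v - s *\<^sub>R z) \<le> c"
      using v[of p] mult_nonneg_nonneg[OF \<open>s \<ge> 0\<close> z_nonneg[of p]]
      by (simp add: inner_diff_right inner_commute)
  qed
  moreover have "s * (z \<bullet> u) = - (\<bar>b\<bar> + \<bar>u \<bullet> v\<bar> + 1)"
    using \<open>z \<bullet> u < 0\<close> by (simp add: s_def)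
  ultimately show False by (simp add: inner_diff_right inner_commute)
qed

text \<open>The vector \<open>e\<close> places \<open>K\<close> in an affine hyperplane that misses
  the origin. So \<open>0 \<notin> K\<close>, and \<open>c *\<^sub>R e\<close> is a point of
  \<open>D\<close> at which every \<open>p\<close> in \<open>K\<close> takes the value
  \<open>c\<close> exactly.\<close>

lemma convex_minimax_inner:
  fixes K S :: "'a::euclidean_space set"
  assumes K: "compact K" "convex K" "K \<noteq> {}" and S: "convex S" "S \<noteq> {}"
    and e: "\<And>p. p \<in> K \<Longrightarrow> p \<bullet> e = 1"
    and less: "\<And>p. p \<in> K \<Longrightarrow> \<exists>w\<in>S. p \<bullet> w < c"
  shows "\<exists>w\<in>S. \<forall>p\<in>K. p \<bullet> w \<le> c"
proof (rule ccontr)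
  define D where "D = {w. \<forall>p\<in>K. p \<bullet> w \<le> c}"
  assume "\<not> (\<exists>w\<in>S. \<forall>p\<in>K. p \<bullet> w \<le> c)"
  then have "D \<inter> S = {}" by (auto simp: D_def)
  moreover have "D = (\<Inter>p\<in>K. {w. p \<bullet> w \<le> c})" by (auto simp: D_def)
  then have "convex D" by (auto intro!: convex_INT convex_halfspace_le)
  moreover have ce: "c *\<^sub>R e \<in> D" using e by (simp add: D_def)
  ultimately obtain u b where u: "u \<noteq> 0"
    and uD: "\<And>w. w \<in> D \<Longrightarrow> u \<bullet> w \<le> b" and uS: "\<And>w. w \<in> S \<Longrightarrow> b \<le> u \<bullet> w"
    using separating_hyperplane_sets[of D S] S by blast
  have "0 \<notin> K" using e by force
  then have "u \<in> conic hull K"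
    using K uD ce by (intro conic_hull_if_bounded_on_halfspaces[where v = "c *\<^sub>R e"])
      (auto simp: D_def)
  then obtain t p where t: "t \<ge> 0" "p \<in> K" "u = t *\<^sub>R p"
    by (auto simp: conic_hull_explicit)
  with u have "t > 0" by auto
  from less[OF \<open>p \<in> K\<close>] obtain w where w: "w \<in> S" "p \<bullet> w < c" by blast
  \<comment> \<open>The two sides of the hyperplane are tested at \<open>c *\<^sub>R e\<close> in
    \<open>D\<close> and at \<open>w\<close> in \<open>S\<close>; with
    \<open>u = t *\<^sub>R p\<close> they contradict each other.\<close>
  have "t * c \<le> b" using uD[OF ce] e t by (simp add: mult.commute)
  also have "b \<le> t * (p \<bullet> w)" using uS[OF w(1)] t by simp
  also have "\<dots> < t * c" using w \<open>t > 0\<close> by simp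
  finally show False by simp
qed

section \<open>Losses as inner products\<close>

lemma compact_range_pmf_vec: "compact (range (pmf_vec :: 'x::finite pmf \<Rightarrow> real ^ 'x))"
proof -
  have "bounded (range (pmf_vec :: 'x pmf \<Rightarrow> real ^ 'x))"
  proof (rule boundedI)
    fix v assume "v \<in> range (pmf_vec :: 'x pmf \<Rightarrow> real ^ 'x)"
    then have "\<forall>i. 0 \<le> v $ i" "(\<Sum>i\<in>UNIV. v $ i) = 1" by (auto simp: range_pmf_vec)
    then show "norm v \<le> 1" using norm_le_l1_cart[of v] by simp
  qed
  moreover have "closed (range (pmf_vec :: 'x pmf \<Rightarrow> real ^ 'x))"
    unfolding range_pmf_vec
    by (intro closed_Collect_conj closed_Collect_all closed_Collect_le closed_Collect_eq
        continuous_intros)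
  ultimately show ?thesis by (simp add: compact_eq_bounded_closed)
qed

definition loss_vec :: "('x::finite \<Rightarrow> 'a \<Rightarrow> real) \<Rightarrow> 'a \<Rightarrow> real ^ 'x" where
  "loss_vec L a = (\<chi> x. L x a)"

lemma loss_act_eq_inner: "loss_act L P a = pmf_vec P \<bullet> loss_vec L a"
  unfolding loss_act_def
  by (subst integral_measure_pmf_real[where A = UNIV])
     (auto simp: pmf_vec_def loss_vec_def inner_vec_def mult.commute)

lemma bounded_loss_vec:
  assumes "bounded ((\<lambda>(x, a). L x a) ` (UNIV \<times> space A))"
  shows "bounded (loss_vec L ` space A)"
proof -
  obtain B where B: "\<And>x a. a \<in> space A \<Longrightarrow> \<bar>L x a\<bar> \<le> B"
    using assms by (auto simp: bounded_iff)
  show ?thesis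
  proof (rule boundedI)
    fix v assume "v \<in> loss_vec L ` space A"
    then obtain a where a: "a \<in> space A" "v = loss_vec L a" by blast
    have "norm v \<le> (\<Sum>x\<in>UNIV. \<bar>v $ x\<bar>)" by (rule norm_le_l1_cart)
    also have "\<dots> \<le> (\<Sum>x\<in>(UNIV :: 'a set). B)"
      using B a by (intro sum_mono) (simp add: loss_vec_def)
    finally show "norm v \<le> (\<Sum>x\<in>(UNIV :: 'a set). B)" .
  qed
qed

lemma gen_entropy_eq_INF_inner:
  assumes "space A \<noteq> {}" "bounded (loss_vec L ` space A)"
  shows "gen_entropy A L P = ereal (INF w\<in>loss_vec L ` space A. pmf_vec P \<bullet> w)"
proof -
  have "bounded ((\<lambda>w. pmf_vec P \<bullet> w) ` loss_vec L ` space A)"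
    using assms(2) by (rule bounded_linear_image[OF _ bounded_linear_inner_right])
  then have "bdd_below ((\<lambda>w. pmf_vec P \<bullet> w) ` loss_vec L ` space A)"
    by (rule bounded_imp_bdd_below)
  then show ?thesis
    using assms(1) by (subst ereal_Inf') (auto simp: gen_entropy_def loss_act_eq_inner image_image)
qed

section \<open>Randomized acts and mixtures of loss vectors\<close>

lemma loss_rand_eq_integral_loss_act:
  fixes L :: "'x::finite \<Rightarrow> 'a \<Rightarrow> real"
  assumes meas: "(\<lambda>(x, a). L x a) \<in> borel_measurable (count_space UNIV \<Otimes>\<^sub>M A)"
    and bnd: "bounded ((\<lambda>(x, a). L x a) ` (UNIV \<times> space A))"
    and \<zeta>: "\<zeta> \<in> space (prob_algebra A)"
  shows "integrable \<zeta> (loss_act L P)" "loss_rand L P \<zeta> = (\<integral>a. loss_act L P a \<partial>\<zeta>)"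
proof -
  have sets: "sets \<zeta> = sets A" and "prob_space \<zeta>" using \<zeta> by (auto simp: space_prob_algebra)
  interpret \<zeta>: prob_space \<zeta> by fact
  interpret pair_prob_space P \<zeta> ..
  obtain B where B: "\<And>x a. a \<in> space A \<Longrightarrow> \<bar>L x a\<bar> \<le> B"
    using bnd by (auto simp: bounded_iff)
  have "sets (measure_pmf P \<Otimes>\<^sub>M \<zeta>) = sets (count_space UNIV \<Otimes>\<^sub>M A)"
    using sets by (intro sets_pair_measure_cong) auto
  then have "(\<lambda>(x, a). L x a) \<in> borel_measurable (measure_pmf P \<Otimes>\<^sub>M \<zeta>)"
    using meas by (simp cong: measurable_cong_sets)
  \<comment> \<open>A bounded measurable function is integrable under a product of probability
    measures, so Fubini lets \<open>x\<close> be integrated out first.\<close>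
  then have int: "integrable (measure_pmf P \<Otimes>\<^sub>M \<zeta>) (\<lambda>(x, a). L x a)"
    using B sets_eq_imp_space_eq[OF sets]
    by (intro P.integrable_const_bound[where B = B] AE_I2) (auto simp: space_pair_measure)
  show "integrable \<zeta> (loss_act L P)"
    using integrable_snd[OF int] by (simp add: loss_act_def[abs_def])
  show "loss_rand L P \<zeta> = (\<integral>a. loss_act L P a \<partial>\<zeta>)"
    using integral_snd[OF int] by (simp add: loss_rand_def loss_act_def split_beta')
qed

text \<open>The weights of a finite convex combination serve as probabilities for drawing an action,
  and linearity turns the expected loss into the inner product with \<open>w\<close>. One act serves
  all \<open>P\<close> at once, as the min-max side of the game demands.\<close>

lemma convex_combination_randomized_act:
  fixes L :: "'x::finite \<Rightarrow> 'a \<Rightarrow> real"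
  assumes meas: "(\<lambda>(x, a). L x a) \<in> borel_measurable (count_space UNIV \<Otimes>\<^sub>M A)"
    and bnd: "bounded ((\<lambda>(x, a). L x a) ` (UNIV \<times> space A))"
    and w: "w \<in> convex hull (loss_vec L ` space A)"
  shows "\<exists>\<zeta>\<in>space (prob_algebra A). \<forall>P. loss_rand L P \<zeta> = pmf_vec P \<bullet> w"
proof -
  obtain S u where S: "finite S" "S \<subseteq> loss_vec L ` space A" "\<And>y. y \<in> S \<Longrightarrow> 0 \<le> u y"
      "sum u S = 1" "(\<Sum>y\<in>S. u y *\<^sub>R y) = w"
    using w unfolding convex_hull_explicit by blast
  from S obtain a0 where a0: "a0 \<in> space A" by fastforce
  define q where "q = embed_pmf (\<lambda>y. if y \<in> S then u y else 0)"
  have "(\<integral>\<^sup>+ y. ennreal (if y \<in> S then u y else 0) \<partial>count_space UNIV) =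
      (\<Sum>y\<in>S. ennreal (u y))"
    using S(1,3) by (subst nn_integral_count_space'[of S]) auto
  also have "\<dots> = 1" using S(3,4) by (simp add: sum_ennreal)
  finally have q: "pmf q y = (if y \<in> S then u y else 0)" for y
    unfolding q_def using S(3) by (subst pmf_embed_pmf) auto
  \<comment> \<open>\<open>f\<close> selects an action for each loss vector in \<open>S\<close>; the
    default \<open>a0\<close> keeps it inside \<open>space A\<close> everywhere, which makes it
    measurable from the discrete measure \<open>q\<close>.\<close>
  define f where "f y = (if y \<in> S then inv_into (space A) (loss_vec L) y else a0)" for y
  have f_space: "f y \<in> space A" for y
    using S(2) a0 by (auto simp: f_def intro!: inv_into_into)
  have f_inv: "loss_vec L (f y) = y" if "y \<in> S" for y
    using that S(2) by (auto simp: f_def intro!: f_inv_into_f)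
  have f: "f \<in> measurable (measure_pmf q) A"
    using f_space by simp
  define \<zeta> where "\<zeta> = distr (measure_pmf q) A f"
  have \<zeta>: "\<zeta> \<in> space (prob_algebra A)"
    using f by (auto simp: \<zeta>_def space_prob_algebra intro!: measure_pmf.prob_space_distr)
  have "loss_rand L P \<zeta> = pmf_vec P \<bullet> w" for P
  proof -
    note loss = loss_rand_eq_integral_loss_act[OF meas bnd \<zeta>, of P]
    have "loss_act L P \<in> borel_measurable A"
      using borel_measurable_integrable[OF loss(1)] by (simp add: \<zeta>_def)
    then have "loss_rand L P \<zeta> = (\<integral>y. loss_act L P (f y) \<partial>measure_pmf q)"
      unfolding loss(2) unfolding \<zeta>_def by (intro integral_distr f)
    also have "\<dots> = (\<Sum>y\<in>S. loss_act L P (f y) * pmf q y)"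
      using S(1) by (intro integral_measure_pmf_real) (auto simp: set_pmf_iff q split: if_splits)
    also have "\<dots> = (\<Sum>y\<in>S. u y * (pmf_vec P \<bullet> y))"
      by (intro sum.cong) (auto simp: q loss_act_eq_inner f_inv)
    also have "\<dots> = pmf_vec P \<bullet> w"
      by (simp add: inner_sum_right flip: S(5))
    finally show ?thesis .
  qed
  with \<zeta> show ?thesis by blast
qed

text \<open>Against a known \<open>P\<close> randomizing gains nothing: an average of losses is
  never below their infimum.\<close>

lemma INF_loss_rand_eq_gen_entropy:
  fixes L :: "'x::finite \<Rightarrow> 'a \<Rightarrow> real"
  assumes ne: "space A \<noteq> {}"
    and meas: "(\<lambda>(x, a). L x a) \<in> borel_measurable (count_space UNIV \<Otimes>\<^sub>M A)"
    and bnd: "bounded ((\<lambda>(x, a). L x a) ` (UNIV \<times> space A))"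
  shows "(INF \<zeta>\<in>space (prob_algebra A). ereal (loss_rand L P \<zeta>)) = gen_entropy A L P"
proof (rule antisym)
  show "(INF \<zeta>\<in>space (prob_algebra A). ereal (loss_rand L P \<zeta>)) \<le> gen_entropy A L P"
    unfolding gen_entropy_def
  proof (rule INF_greatest)
    fix a assume "a \<in> space A"
    then have "loss_vec L a \<in> convex hull (loss_vec L ` space A)"
      by (intro hull_inc imageI)
    \<comment> \<open>The act obtained need not be concentrated at \<open>a\<close>; only its loss
      matters.\<close>
    from convex_combination_randomized_act[OF meas bnd this]
    obtain \<zeta> where "\<zeta> \<in> space (prob_algebra A)" "loss_rand L P \<zeta> = loss_act L P a"
      by (auto simp: loss_act_eq_inner)
    then show "(INF \<zeta>\<in>space (prob_algebra A). ereal (loss_rand L P \<zeta>)) \<le> ereal (loss_act L P a)"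
      by (metis INF_lower)
  qed
  obtain h where h: "gen_entropy A L P = ereal h"
    using gen_entropy_eq_INF_inner[OF ne bounded_loss_vec[OF bnd]] by blast
  have h_le: "h \<le> loss_act L P a" if "a \<in> space A" for a
    using INF_lower[OF that, of "\<lambda>a. ereal (loss_act L P a)"] h by (simp add: gen_entropy_def)
  show "gen_entropy A L P \<le> (INF \<zeta>\<in>space (prob_algebra A). ereal (loss_rand L P \<zeta>))"
  proof (rule INF_greatest)
    fix \<zeta> assume \<zeta>: "\<zeta> \<in> space (prob_algebra A)"
    then have "sets \<zeta> = sets A" "prob_space \<zeta>" by (auto simp: space_prob_algebra)
    then have "h \<le> (\<integral>a. loss_act L P a \<partial>\<zeta>)"
      using loss_rand_eq_integral_loss_act(1)[OF meas bnd \<zeta>] h_le sets_eq_imp_space_eq[of \<zeta> A]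
      by (intro prob_space.integral_ge_const AE_I2) auto
    then show "gen_entropy A L P \<le> ereal (loss_rand L P \<zeta>)"
      by (simp add: h loss_rand_eq_integral_loss_act(2)[OF meas bnd \<zeta>])
  qed
qed

theorem theorem5p1:
  fixes A :: "'a measure"
    and L :: "'x::finite \<Rightarrow> 'a \<Rightarrow> real"
    and \<Gamma> :: "'x pmf set"
  assumes "space A \<noteq> {}"
    and "\<And>a. a \<in> space A \<Longrightarrow> {a} \<in> sets A"
    and "(\<lambda>(x, a). L x a) \<in> borel_measurable (count_space UNIV \<Otimes>\<^sub>M A)"
    and "bounded ((\<lambda>(x, a). L x a) ` (UNIV \<times> space A))"
    and "\<Gamma> \<noteq> {}"
    and "closed_pmf_set \<Gamma>"
    and "convex_pmf_set \<Gamma>"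
  shows "\<exists>H\<^sub>0. game_has_value \<Gamma> A L H\<^sub>0 \<and>
           (\<exists>P\<^sub>0\<in>\<Gamma>. gen_entropy A L P\<^sub>0 = ereal H\<^sub>0 \<and>
              (\<forall>P\<in>\<Gamma>. gen_entropy A L P \<le> gen_entropy A L P\<^sub>0))"
proof -
  define W where "W = loss_vec L ` space A"
  define K where "K = pmf_vec ` \<Gamma>"
  define h where "h p = (INF w\<in>W. p \<bullet> w)" for p
  have W: "W \<noteq> {}" "bounded W"
    using assms(1) bounded_loss_vec[OF assms(4)] by (auto simp: W_def)
  have entropy: "gen_entropy A L P = ereal (h (pmf_vec P))" for P
    using gen_entropy_eq_INF_inner[OF assms(1), of L P] W(2) by (simp add: W_def h_def)
  have INF_rand: "(INF \<zeta>\<in>space (prob_algebra A). ereal (loss_rand L P \<zeta>)) = gen_entropy A L P" for P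
    by (rule INF_loss_rand_eq_gen_entropy[OF assms(1,3,4)])
  have K: "compact K" "convex K" "K \<noteq> {}"
    using assms(5-7) closedin_compact[OF compact_range_pmf_vec]
    by (auto simp: K_def closed_pmf_set_def convex_pmf_set_def)
  obtain P0 where P0: "P0 \<in> \<Gamma>" and max: "\<And>P. P \<in> \<Gamma> \<Longrightarrow> h (pmf_vec P) \<le> h (pmf_vec P0)"
    using continuous_attains_sup[OF K(1,3) continuous_on_INF_inner[OF W]]
    by (auto simp: K_def h_def)
  define H where "H = h (pmf_vec P0)"

  have max_min: "(SUP P\<in>\<Gamma>. INF \<zeta>\<in>space (prob_algebra A). ereal (loss_rand L P \<zeta>)) = ereal H"
    unfolding INF_rand entropy
    using P0 max by (intro antisym SUP_least SUP_upper2[of P0]) (auto simp: H_def)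
  have min_max: "(INF \<zeta>\<in>space (prob_algebra A). SUP P\<in>\<Gamma>. ereal (loss_rand L P \<zeta>)) = ereal H"
  proof (rule antisym)
    show "(INF \<zeta>\<in>space (prob_algebra A). SUP P\<in>\<Gamma>. ereal (loss_rand L P \<zeta>)) \<le> ereal H"
    \<comment> \<open>The slack \<open>\<epsilon>\<close> supplies the strict inequality required by
      the minimax principle; the infimum over acts need not be attained.\<close>
    proof (rule ereal_le_epsilon2)
      fix \<epsilon> :: real assume "\<epsilon> > 0"
      have "\<exists>w\<in>convex hull W. \<forall>p\<in>K. p \<bullet> w \<le> H + \<epsilon>"
      \<comment> \<open>For the all-ones vector the normalization \<open>p \<bullet> e = 1\<close>
        says that probabilities sum to 1.\<close>
      proof (rule convex_minimax_inner[OF K, where e = "\<chi> i. 1"])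
        fix p assume "p \<in> K"
        then obtain P where P: "P \<in> \<Gamma>" "p = pmf_vec P" by (auto simp: K_def)
        then show "p \<bullet> (\<chi> i. 1) = 1"
          by (simp add: inner_vec_def pmf_vec_def sum_pmf_eq_1)
        have "(INF w\<in>W. p \<bullet> w) < H + \<epsilon>"
          using max[OF P(1)] P(2) \<open>\<epsilon> > 0\<close> by (simp add: h_def H_def)
        then obtain w where "w \<in> W" "p \<bullet> w < H + \<epsilon>"
          using cInf_lessD[of "(\<lambda>w. p \<bullet> w) ` W"] W(1) by auto
        then show "\<exists>w\<in>convex hull W. p \<bullet> w < H + \<epsilon>" by (meson hull_inc)
      qed (use W in auto)
      then obtain w where w: "w \<in> convex hull W" "\<And>P. P \<in> \<Gamma> \<Longrightarrow> pmf_vec P \<bullet> w \<le> H + \<epsilon>"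
        by (auto simp: K_def)
      obtain \<zeta> where \<zeta>: "\<zeta> \<in> space (prob_algebra A)" "\<And>P. loss_rand L P \<zeta> = pmf_vec P \<bullet> w"
        using convex_combination_randomized_act[OF assms(3,4) w(1)[unfolded W_def]] by blast
      show "(INF \<zeta>\<in>space (prob_algebra A). SUP P\<in>\<Gamma>. ereal (loss_rand L P \<zeta>)) \<le> ereal H + ereal \<epsilon>"
        using \<zeta> w(2) by (intro INF_lower2[OF \<zeta>(1)] SUP_least) simp
    qed
    \<comment> \<open>Weak duality: against any act Nature can answer with \<open>P0\<close>, which
      costs at least the entropy of \<open>P0\<close>.\<close>
    show "ereal H \<le> (INF \<zeta>\<in>space (prob_algebra A). SUP P\<in>\<Gamma>. ereal (loss_rand L P \<zeta>))"
    proof (rule INF_greatest, rule SUP_upper2[OF P0])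
      fix \<zeta> assume "\<zeta> \<in> space (prob_algebra A)"
      then show "ereal H \<le> ereal (loss_rand L P0 \<zeta>)"
        using INF_rand[of P0] by (metis H_def entropy INF_lower)
    qed
  qed
  have "game_has_value \<Gamma> A L H"
    by (simp add: game_has_value_def max_min min_max)
  then show ?thesis
    using P0 max by (auto simp: entropy H_def)
qed

end
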